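(* Let $p,q,n$ be positive integers with $n\ge p$ and $n\ge q$, and let $a\in M_{p\times q}(\mathbb N)$. Then $$\int_{O_n}\prod_{i=1}^p\prod_{j=1}^q u_{ij}^{a_{ij}}\,du=0,$$ unless $a$ is admissible, in the sense that all $p$ row sums $\sum_j a_{ij}$ and all $q$ column sums $\sum_i a_{ij}$ are even numbers.
   Context: $\mathbb N=\{0,1,2,\ldots\}$. $O_n$ is the group of real orthogonal $n\times n$ matrices $u=(u_{ij})$, and $du$ is its normalized (probability) Haar measure. *)

theory Defs
  imports "HOL-Probability.Probability"
begin

definition orthogonal_group :: "(real ^ 'n ^ 'n) set" where
  "orthogonal_group = {u. orthogonal_matrix u}"

text \<open>
  Normalized Haar measure on the orthogonal group: a left invariant Borel probability measure.
  Regularity is not required separately, since it is automatic for finite Borel measures on a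
  compact metrizable space. These conditions determine the measure uniquely, and (the group being
  compact) they imply right invariance, which is therefore not part of the definition.
\<close>

definition normalized_haar_measure :: "(real ^ 'n ^ 'n) measure \<Rightarrow> bool" where
  "normalized_haar_measure \<mu> \<longleftrightarrow>
     sets \<mu> = sets (restrict_space borel orthogonal_group) \<and>
     prob_space \<mu> \<and>
     (\<forall>g \<in> orthogonal_group. \<forall>A \<in> sets \<mu>. emeasure \<mu> ((\<lambda>u. g ** u) ` A) = emeasure \<mu> A)"

text \<open>
  A \<open>p \<times> q\<close> matrix over the naturals is a function \<open>nat \<Rightarrow> nat \<Rightarrow> nat\<close> of which only the values at
  \<open>i \<in> {1..p}\<close>, \<open>j \<in> {1..q}\<close> matter.
\<close>

definition admissible :: "nat \<Rightarrow> nat \<Rightarrow> (nat \<Rightarrow> nat \<Rightarrow> nat) \<Rightarrow> bool" where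
  "admissible p q a \<longleftrightarrow>
     (\<forall>i \<in> {1..p}. even (\<Sum>j = 1..q. a i j)) \<and>
     (\<forall>j \<in> {1..q}. even (\<Sum>i = 1..p. a i j))"

text \<open>
  The indices of a matrix of type \<open>real ^ 'n ^ 'n\<close> are the elements of \<open>'n\<close>, which carries no
  canonical numbering. For an enumeration \<open>e\<close> of \<open>'n\<close> by \<open>1, \<dots>, CARD('n)\<close>, used for rows and columns
  alike, the numbered entry \<open>u\<^sub>i\<^sub>j\<close> is:
\<close>

definition entry :: "(nat \<Rightarrow> 'n) \<Rightarrow> real ^ 'n ^ 'n \<Rightarrow> nat \<Rightarrow> nat \<Rightarrow> real" where
  "entry e u i j = u $ e i $ e j"

definition index_enumeration :: "(nat \<Rightarrow> 'n::finite) \<Rightarrow> bool" where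
  "index_enumeration e \<longleftrightarrow> bij_betw e {1..CARD('n)} UNIV"

end

theory Submission
  imports Defs
begin

text \<open>
  Multiplying \<open>u\<close> on the left by the reflection in the \<open>i\<close>-th coordinate negates row \<open>i\<close>, so an odd
  row sum makes the integral equal to its own negative. Odd column sums reduce to this case because
  the measure is invariant under transposition: \<open>\<integral>\<integral> f (x\<^sup>T y) dx dy\<close> equals \<open>\<integral> f y dy\<close> by invariance
  in \<open>y\<close> and, since \<open>x\<^sup>T y = (y\<^sup>T x)\<^sup>T\<close>, equals \<open>\<integral> f (x\<^sup>T) dx\<close> by invariance in \<open>x\<close>.
\<close>

lemma mult_orthogonal_group:
  fixes g u :: "real ^ 'n ^ 'n"
  assumes "g \<in> orthogonal_group" "u \<in> orthogonal_group"
  shows "g ** u \<in> orthogonal_group"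
  using assms by (simp add: orthogonal_group_def orthogonal_matrix_mul)

lemma transpose_orthogonal_group:
  fixes u :: "real ^ 'n ^ 'n"
  assumes "u \<in> orthogonal_group"
  shows "transpose u \<in> orthogonal_group"
  using assms by (simp add: orthogonal_group_def)

lemma continuous_on_matrix_mult [continuous_intros]:
  fixes f :: "'a::topological_space \<Rightarrow> real ^ 'n::finite ^ 'm::finite"
    and g :: "'a \<Rightarrow> real ^ 'k::finite ^ 'n"
  assumes "continuous_on S f" "continuous_on S g"
  shows "continuous_on S (\<lambda>x. f x ** g x)"
  unfolding matrix_matrix_mult_def by (intro continuous_intros assms)

lemma continuous_on_transpose [continuous_intros]:
  fixes f :: "'a::topological_space \<Rightarrow> real ^ 'n::finite ^ 'm::finite"
  assumes "continuous_on S f"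
  shows "continuous_on S (\<lambda>x. transpose (f x))"
  unfolding transpose_def by (intro continuous_intros assms)

context
  fixes \<mu> :: "(real ^ 'n::finite ^ 'n) measure"
  assumes haar: "normalized_haar_measure \<mu>"
begin

lemma sets_haar: "sets \<mu> = sets (restrict_space borel orthogonal_group)"
  and prob_space_haar: "prob_space \<mu>"
  using haar by (auto simp: normalized_haar_measure_def)

lemma space_haar: "space \<mu> = orthogonal_group"
  using sets_eq_imp_space_eq[OF sets_haar] by (simp add: space_restrict_space)

text \<open>The \<sigma>-algebra of \<open>\<mu>\<close> is the trace of the Borel sets on the
  group, so a Borel measurable map whose values are orthogonal matrices is measurable into
  \<open>\<mu>\<close>.\<close>

lemma measurable_into_haar:
  assumes "f \<in> borel_measurable M" "\<And>x. x \<in> space M \<Longrightarrow> f x \<in> orthogonal_group"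
  shows "f \<in> measurable M \<mu>"
  unfolding measurable_cong_sets[OF refl sets_haar]
  using assms by (intro measurable_restrict_space2) auto

lemma measurable_from_haar:
  assumes "f \<in> borel_measurable borel"
  shows "f \<in> borel_measurable \<mu>"
  unfolding measurable_cong_sets[OF sets_haar refl]
  using assms by (rule measurable_restrict_space1)

lemma measurable_haar_mult:
  assumes "g \<in> orthogonal_group"
  shows "(\<lambda>u. g ** u) \<in> measurable \<mu> \<mu>"
  using assms
  by (intro measurable_into_haar measurable_from_haar borel_measurable_continuous_onI
      continuous_intros) (auto simp: space_haar intro: mult_orthogonal_group)

lemma measurable_haar_transpose: "transpose \<in> measurable \<mu> \<mu>"
proof (rule measurable_into_haar)
  show "transpose \<in> borel_measurable \<mu>"
    by (intro measurable_from_haar borel_measurable_continuous_onI continuous_on_transpose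
        continuous_on_id)
qed (auto simp: space_haar intro: transpose_orthogonal_group)

text \<open>The definition of Haar measure speaks of images of sets, a push-forward of preimages.
  The two agree because left multiplication by \<open>g\<close> is a bijection of the group with
  inverse \<open>transpose g\<close>, which is again orthogonal.\<close>

lemma distr_haar_mult:
  assumes g: "g \<in> orthogonal_group"
  shows "distr \<mu> \<mu> (\<lambda>u. g ** u) = \<mu>"
proof (rule measure_eqI)
  fix A assume "A \<in> sets (distr \<mu> \<mu> (\<lambda>u. g ** u))"
  then have A: "A \<in> sets \<mu>" by simp
  have gg: "transpose g ** g = mat 1" "g ** transpose g = mat 1"
    using g by (auto simp: orthogonal_group_def orthogonal_matrix_def)
  have "A \<subseteq> orthogonal_group"
    using sets.sets_into_space[OF A] by (simp add: space_haar)
  then have "(\<lambda>u. g ** u) -` A \<inter> space \<mu> = (\<lambda>u. transpose g ** u) ` A"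
    using g by (force simp: space_haar matrix_mul_assoc gg image_iff
        intro: mult_orthogonal_group transpose_orthogonal_group)
  then show "emeasure (distr \<mu> \<mu> (\<lambda>u. g ** u)) A = emeasure \<mu> A"
    using haar A transpose_orthogonal_group[OF g]
    by (simp add: emeasure_distr measurable_haar_mult g normalized_haar_measure_def)
qed simp

lemma nn_integral_haar_mult:
  assumes "g \<in> orthogonal_group" "f \<in> borel_measurable \<mu>"
  shows "(\<integral>\<^sup>+u. f (g ** u) \<partial>\<mu>) = (\<integral>\<^sup>+u. f u \<partial>\<mu>)"
  using nn_integral_distr[OF measurable_haar_mult[OF assms(1)], of f]
  by (simp add: distr_haar_mult assms)

lemma integral_haar_mult:
  fixes f :: "real ^ 'n ^ 'n \<Rightarrow> real"
  assumes "g \<in> orthogonal_group" "f \<in> borel_measurable \<mu>"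
  shows "(\<integral>u. f (g ** u) \<partial>\<mu>) = (\<integral>u. f u \<partial>\<mu>)"
  using integral_distr[OF measurable_haar_mult[OF assms(1)] assms(2)]
  by (simp add: distr_haar_mult assms)

text \<open>Stated for nonnegative extended functions, so that the exchange of integrals requires
  only measurability and no integrability.\<close>

lemma nn_integral_haar_transpose:
  assumes f: "f \<in> borel_measurable \<mu>"
  shows "(\<integral>\<^sup>+u. f (transpose u) \<partial>\<mu>) = (\<integral>\<^sup>+u. f u \<partial>\<mu>)"
proof -
  interpret prob_space \<mu> by (rule prob_space_haar)
  interpret pair_sigma_finite \<mu> \<mu> ..
  have borel_id: "(\<lambda>u. u) \<in> borel_measurable \<mu>"
    by (rule measurable_from_haar) simp
  \<comment> \<open>Each coordinate, read as a Borel measurable matrix through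
    \<open>borel_id\<close>, enters a continuous function of two variables; this gives joint
    measurability.\<close>
  have "(\<lambda>z. transpose (fst z) ** snd z) \<in> borel_measurable (\<mu> \<Otimes>\<^sub>M \<mu>)"
    using measurable_compose[OF measurable_fst borel_id] measurable_compose[OF measurable_snd borel_id]
    by (intro borel_measurable_continuous_Pair[where H = "\<lambda>x y. transpose x ** y"] continuous_intros)
  then have "(\<lambda>z. transpose (fst z) ** snd z) \<in> measurable (\<mu> \<Otimes>\<^sub>M \<mu>) \<mu>"
    by (rule measurable_into_haar)
      (auto simp: space_pair_measure space_haar mult_orthogonal_group transpose_orthogonal_group)
  from measurable_compose[OF this f]
  have meas: "(\<lambda>(x, y). f (transpose x ** y)) \<in> borel_measurable (\<mu> \<Otimes>\<^sub>M \<mu>)"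
    by (simp add: case_prod_unfold)
  \<comment> \<open>The total mass is 1, so integrating a constant over a dummy variable
    \<open>y\<close> changes nothing; for each fixed \<open>y\<close> the inner integral can then be
    translated by \<open>transpose y\<close>.\<close>
  have "(\<integral>\<^sup>+u. f (transpose u) \<partial>\<mu>) = (\<integral>\<^sup>+y. \<integral>\<^sup>+u. f (transpose u) \<partial>\<mu> \<partial>\<mu>)"
    by (simp add: emeasure_space_1)
  also have "\<dots> = (\<integral>\<^sup>+y. \<integral>\<^sup>+x. f (transpose (transpose y ** x)) \<partial>\<mu> \<partial>\<mu>)"
    by (rule nn_integral_cong)
      (auto simp: space_haar transpose_orthogonal_group
        measurable_compose[OF measurable_haar_transpose f]
        nn_integral_haar_mult[where f = "\<lambda>u. f (transpose u)"])
  also have "\<dots> = (\<integral>\<^sup>+y. \<integral>\<^sup>+x. f (transpose x ** y) \<partial>\<mu> \<partial>\<mu>)"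
    by (simp add: matrix_transpose_mul)
  also have "\<dots> = (\<integral>\<^sup>+x. \<integral>\<^sup>+y. f (transpose x ** y) \<partial>\<mu> \<partial>\<mu>)"
    by (rule Fubini'[OF meas])
  also have "\<dots> = (\<integral>\<^sup>+x. \<integral>\<^sup>+y. f y \<partial>\<mu> \<partial>\<mu>)"
    by (rule nn_integral_cong)
      (auto simp: space_haar transpose_orthogonal_group nn_integral_haar_mult f)
  finally show ?thesis
    by (simp add: emeasure_space_1)
qed

text \<open>Applying the nonnegative case to indicators turns it into an identity of measures, from
  which the rule for real-valued integrands follows by change of variables.\<close>

lemma distr_haar_transpose: "distr \<mu> \<mu> transpose = \<mu>"
proof (rule measure_eqI)
  fix A assume "A \<in> sets (distr \<mu> \<mu> transpose)"
  then have A: "A \<in> sets \<mu>" by simp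
  have "emeasure (distr \<mu> \<mu> transpose) A = (\<integral>\<^sup>+u. indicator A u \<partial>distr \<mu> \<mu> transpose)"
    using A by simp
  also have "\<dots> = (\<integral>\<^sup>+u. indicator A (transpose u) \<partial>\<mu>)"
    using A by (intro nn_integral_distr measurable_haar_transpose) simp
  also have "\<dots> = emeasure \<mu> A"
    using A by (simp add: nn_integral_haar_transpose)
  finally show "emeasure (distr \<mu> \<mu> transpose) A = emeasure \<mu> A" .
qed simp

lemma integral_haar_transpose:
  fixes f :: "real ^ 'n ^ 'n \<Rightarrow> real"
  assumes "f \<in> borel_measurable \<mu>"
  shows "(\<integral>u. f (transpose u) \<partial>\<mu>) = (\<integral>u. f u \<partial>\<mu>)"
  using integral_distr[OF measurable_haar_transpose assms] by (simp add: distr_haar_transpose)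

lemma measurable_entry_monomial:
  "(\<lambda>u. \<Prod>i = 1..p. \<Prod>j = 1..q. entry e u i j ^ a i j) \<in> borel_measurable \<mu>"
  unfolding entry_def
  by (intro measurable_from_haar borel_measurable_continuous_onI continuous_intros)

lemma integral_entry_monomial_odd_row:
  assumes e: "inj_on e {1..p}" and k: "k \<in> {1..p}" and odd: "odd (\<Sum>j = 1..q. a k j)"
  shows "(\<integral>u. (\<Prod>i = 1..p. \<Prod>j = 1..q. entry e u i j ^ a i j) \<partial>\<mu>) = 0"
proof -
  \<comment> \<open>\<open>g\<close> is the diagonal matrix with diagonal \<open>s\<close>, that is,
    the reflection in coordinate \<open>e k\<close>.\<close>
  define s :: "'n \<Rightarrow> real" where "s l = (if l = e k then -1 else 1)" for l
  define g :: "real ^ 'n ^ 'n" where "g = (\<chi> i j. if i = j then s i else 0)"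
  define F where "F u = (\<Prod>i = 1..p. \<Prod>j = 1..q. entry e u i j ^ a i j)" for u
  have entry_g: "entry e (g ** u) i j = s (e i) * entry e u i j" for u i j
    by (simp add: entry_def g_def matrix_matrix_mult_def if_distrib[of "\<lambda>x. x * _"] cong: if_cong)
  have "transpose g ** g = mat 1"
    by (simp add: vec_eq_iff g_def s_def matrix_matrix_mult_def transpose_def mat_def
        if_distrib[of "\<lambda>x. x * _"] cong: if_cong)
  then have g: "g \<in> orthogonal_group"
    by (simp add: orthogonal_group_def orthogonal_matrix)
  \<comment> \<open>This is the total sign by which \<open>g\<close> changes the monomial. By
    injectivity of \<open>e\<close> only the factor \<open>i = k\<close> involves the entry -1 of
    \<open>s\<close>, and its exponent is the odd row sum.\<close>
  have "(\<Prod>i = 1..p. s (e i) ^ (\<Sum>j = 1..q. a i j)) = (\<Prod>i = 1..p. if i = k then -1 else 1)"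
    using e k odd by (intro prod.cong) (auto simp: s_def dest: inj_onD)
  also have "\<dots> = -1"
    using k by simp
  finally have "F (g ** u) = - F u" for u
    by (simp add: F_def entry_g power_mult_distrib prod.distrib power_sum)
  \<comment> \<open>Translation by \<open>g\<close> preserves the integral, while pulling out the
    sign is valid for the Bochner integral of any function, so integrability of \<open>F\<close>
    need not be established.\<close>
  then have "(\<integral>u. F u \<partial>\<mu>) = - (\<integral>u. F u \<partial>\<mu>)"
    using integral_haar_mult[OF g, of F] measurable_entry_monomial[where p = p and q = q and e = e and a = a]
    by (simp add: F_def[abs_def])
  then show ?thesis
    by (simp add: F_def)
qed

end

theorem corollary2p3:
  fixes p q :: nat
    and a :: "nat \<Rightarrow> nat \<Rightarrow> nat"
    and e :: "nat \<Rightarrow> 'n::finite"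
    and \<mu> :: "(real ^ 'n ^ 'n) measure"
  assumes "p \<ge> 1" and "q \<ge> 1"
    and "CARD('n) \<ge> p" and "CARD('n) \<ge> q"
    and "index_enumeration e"
    and "normalized_haar_measure \<mu>"
    and "\<not> admissible p q a"
  shows "(\<integral>u. (\<Prod>i = 1..p. \<Prod>j = 1..q. entry e u i j ^ a i j) \<partial>\<mu>) = 0"
proof -
  have "inj_on e {1..CARD('n)}"
    using assms(5) by (simp add: index_enumeration_def bij_betw_def)
  then have inj: "inj_on e {1..p}" "inj_on e {1..q}"
    using assms(3,4) by (auto elim: inj_on_subset)
  consider k where "k \<in> {1..p}" "odd (\<Sum>j = 1..q. a k j)"
    | k where "k \<in> {1..q}" "odd (\<Sum>i = 1..p. a i k)"
    using assms(7) by (auto simp: admissible_def)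
  then show ?thesis
  proof cases
    case 1
    with integral_entry_monomial_odd_row[OF assms(6) inj(1)] show ?thesis by blast
  next
    case 2
    have "(\<integral>u. (\<Prod>i = 1..p. \<Prod>j = 1..q. entry e u i j ^ a i j) \<partial>\<mu>) =
        (\<integral>u. (\<Prod>i = 1..p. \<Prod>j = 1..q. entry e (transpose u) i j ^ a i j) \<partial>\<mu>)"
      using integral_haar_transpose[OF assms(6) measurable_entry_monomial[OF assms(6)]] by simp
    \<comment> \<open>Transposing \<open>u\<close> and swapping the products gives the monomial of
      the transposed exponent matrix, of size \<open>q\<close> by \<open>p\<close>, whose row
      \<open>k\<close> has the odd sum of column \<open>k\<close> of \<open>a\<close>.\<close>
    also have "\<dots> = (\<integral>u. (\<Prod>j = 1..q. \<Prod>i = 1..p. entry e u j i ^ a i j) \<partial>\<mu>)"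
      by (subst prod.swap) (simp add: entry_def transpose_def)
    also have "\<dots> = 0"
      using integral_entry_monomial_odd_row[OF assms(6) inj(2) 2(1), where q = p and a = "\<lambda>j i. a i j"] 2(2)
      by simp
    finally show ?thesis .
  qed
qed

end
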